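(* Let $k\ge2$ and let $G$ be a $k$-graph with vertex set $\{1,\dots,n\}$ in which every vertex lies in at least one edge. Let $\delta$ be the minimum degree of $G$ and $\mathcal Q$ its signless Laplacian tensor. If $k\ge 3$, then the smallest H$^+$-eigenvalue of $\mathcal Q$ is $\delta$. Moreover, for every $k\ge2$, $$\delta=\min\Big\{\mathcal Qx^k : x\in\mathbb R^n_+,\ \sum_{i=1}^n x_i^k=1\Big\}.$$
   Context: A $k$-graph $G=(V,E)$ consists of a vertex set $V=\{1,\dots,n\}$ and a set $E$ of distinct $k$-element subsets of $V$ (edges). Standing assumption: every vertex lies in at least one edge. The degree $d_i$ of vertex $i$ is the number of edges containing $i$; $\delta=\min_i d_i$. The adjacency tensor $\mathcal A=(a_{i_1\cdots i_k})$ is the $k$th order $n$-dimensional symmetric tensor with $a_{i_1\cdots i_k}=\frac1{(k-1)!}$ if $\{i_1,\dots,i_k\}\in E$ (in particular the indices are then distinct), and $0$ otherwise. The degree tensor $\mathcal D$ is the $k$th order $n$-dimensional diagonal tensor with $i$th diagonal entry $d_i$. The signless Laplacian tensor is $\mathcal Q=\mathcal D+\mathcal A$. For a real $k$th order $n$-dimensional tensor $\mathcal T=(t_{i_1\cdots i_k})$ and a vector $x$, $\mathcal Tx^k=\sum_{i_1,\dots,i_k=1}^n t_{i_1\cdots i_k}x_{i_1}\cdots x_{i_k}$, $\mathcal Tx^{k-1}$ is the vector with $i$th component $\sum_{i_2,\dots,i_k=1}^n t_{ii_2\cdots i_k}x_{i_2}\cdots x_{i_k}$, and $x^{[k-1]}$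 is the vector with components $x_i^{k-1}$. A real number $\lambda$ is an H$^+$-eigenvalue of $\mathcal T$ if there is a nonzero $x\in\mathbb R^n_+$ with $\mathcal Tx^{k-1}=\lambda x^{[k-1]}$, where $\mathbb R^n_+$ is the set of vectors in $\mathbb R^n$ with nonnegative components. *)

theory Defs
  imports "HOL-Analysis.Analysis"
begin

text \<open>
  The vertex set \<open>{1, \<dots>, n}\<close> is the index type \<open>'n::finite\<close>, so that \<open>n = CARD('n) \<ge> 1\<close>
  and vectors of \<open>\<real>\<^sup>n\<close> are of type \<open>real ^ 'n\<close>. A hypergraph is given by its edge set.
\<close>

definition k_graph :: "nat \<Rightarrow> 'n::finite set set \<Rightarrow> bool" where
  "k_graph k E \<longleftrightarrow> (\<forall>e\<in>E. card e = k)"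

definition no_isolated_vertex :: "'n::finite set set \<Rightarrow> bool" where
  "no_isolated_vertex E \<longleftrightarrow> (\<forall>i. \<exists>e\<in>E. i \<in> e)"

definition degree :: "'n::finite set set \<Rightarrow> 'n \<Rightarrow> nat" where
  "degree E i = card {e \<in> E. i \<in> e}"

definition min_degree :: "'n::finite set set \<Rightarrow> nat" where
  "min_degree E = Min (range (degree E))"

text \<open>
  The entry \<open>t\<^bsub>i\<^sub>1 \<dots> i\<^sub>k\<^esub>\<close> of a tensor \<open>T\<close> of order \<open>k\<close> is \<open>T [i\<^sub>1, \<dots>, i\<^sub>k]\<close>. Values of \<open>T\<close>
  on lists of a length other than \<open>k\<close> have no meaning and are never used at order \<open>k\<close>.
\<close>

type_synonym 'n tensor = "'n list \<Rightarrow> real"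

definition tensor_form :: "nat \<Rightarrow> 'n::finite tensor \<Rightarrow> real ^ 'n \<Rightarrow> real" where
  "tensor_form k T x = (\<Sum>js | length js = k. T js * (\<Prod>j\<leftarrow>js. x $ j))"

definition tensor_apply :: "nat \<Rightarrow> 'n::finite tensor \<Rightarrow> real ^ 'n \<Rightarrow> real ^ 'n" where
  "tensor_apply k T x = (\<chi> i. \<Sum>js | length js = k - 1. T (i # js) * (\<Prod>j\<leftarrow>js. x $ j))"

definition vec_power :: "real ^ 'n::finite \<Rightarrow> nat \<Rightarrow> real ^ 'n" where
  "vec_power x m = (\<chi> i. (x $ i) ^ m)"

definition nonneg_orthant :: "(real ^ 'n::finite) set" where
  "nonneg_orthant = {x. \<forall>i. 0 \<le> x $ i}"

definition Hplus_eigenvalue :: "nat \<Rightarrow> 'n::finite tensor \<Rightarrow> real \<Rightarrow> bool" where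
  "Hplus_eigenvalue k T l \<longleftrightarrow>
     (\<exists>x \<in> nonneg_orthant. x \<noteq> 0 \<and> tensor_apply k T x = l *\<^sub>R vec_power x (k - 1))"

text \<open>
  An edge has \<open>k\<close> elements, so \<open>set js \<in> E\<close> with \<open>length js = k\<close> forces the indices to be distinct.
\<close>

definition adjacency_tensor :: "nat \<Rightarrow> 'n::finite set set \<Rightarrow> 'n tensor" where
  "adjacency_tensor k E js = (if length js = k \<and> set js \<in> E then 1 / fact (k - 1) else 0)"

definition degree_tensor :: "nat \<Rightarrow> 'n::finite set set \<Rightarrow> 'n tensor" where
  "degree_tensor k E js = (if js = replicate k (hd js) then real (degree E (hd js)) else 0)"

definition signless_laplacian :: "nat \<Rightarrow> 'n::finite set set \<Rightarrow> 'n tensor" where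
  "signless_laplacian k E js = degree_tensor k E js + adjacency_tensor k E js"

definition is_minimum :: "real \<Rightarrow> real set \<Rightarrow> bool" where
  "is_minimum m S \<longleftrightarrow> m \<in> S \<and> (\<forall>s\<in>S. m \<le> s)"

end

theory Submission
  imports Defs
begin

text \<open>
  On nonnegative vectors the adjacency part of \<open>Q = D + A\<close> only contributes nonnegative terms.
  Reading the eigenvalue equation at a coordinate with \<open>x\<^sub>i > 0\<close> therefore gives \<open>\<lambda> \<ge> d\<^sub>i\<close>, and
  summing over all coordinates bounds the form below by \<open>\<delta> (\<Sum>i. x\<^sub>i\<^sup>k)\<close>. Both bounds are
  attained at the unit vector of a vertex of minimum degree: a product over two or more distinct
  coordinates vanishes there. The tensor is applied to \<open>k - 1\<close> coordinates of an edge, which is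
  why the eigenvalue claim needs \<open>k \<ge> 3\<close>.
\<close>

lemma finite_lists_length: "finite {js :: 'n::finite list. length js = m}"
  using finite_lists_length_eq[of "UNIV :: 'n set" m] by simp

text \<open>Two distinct entries cannot both equal \<open>i\<close>, so some factor is a zero
  coordinate of the unit vector.\<close>

lemma prod_list_axis_eq_0:
  fixes i :: "'n::finite"
  assumes "card (set js) \<ge> 2"
  shows "(\<Prod>j\<leftarrow>js. axis i (1::real) $ j) = 0"
proof -
  have "\<not> set js \<subseteq> {i}"
    using assms card_mono[of "{i}" "set js"] by auto
  then obtain j where "j \<in> set js" "j \<noteq> i" by auto
  then have "axis i (1::real) $ j = 0" by (simp add: axis_def)
  with \<open>j \<in> set js\<close> have "0 \<in> set (map (\<lambda>j. axis i (1::real) $ j) js)" by force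
  then show ?thesis by (simp only: prod_list_zero_iff)
qed

lemma prod_list_nonneg_orthant:
  assumes "x \<in> nonneg_orthant"
  shows "0 \<le> (\<Prod>j\<leftarrow>js. x $ j)"
  using assms by (induction js) (auto simp: nonneg_orthant_def)

lemma tensor_form_add:
  "tensor_form k (\<lambda>js. S js + T js) x = tensor_form k S x + tensor_form k T x"
  by (simp add: tensor_form_def distrib_right sum.distrib)

lemma tensor_apply_add:
  "tensor_apply k (\<lambda>js. S js + T js) x = tensor_apply k S x + tensor_apply k T x"
  by (simp add: tensor_apply_def vec_eq_iff distrib_right sum.distrib)

lemma tensor_form_nonneg:
  assumes "\<And>js. 0 \<le> T js" "x \<in> nonneg_orthant"
  shows "0 \<le> tensor_form k T x"
  unfolding tensor_form_def
  using assms prod_list_nonneg_orthant by (intro sum_nonneg mult_nonneg_nonneg) auto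

lemma tensor_apply_nonneg:
  assumes "\<And>js. 0 \<le> T js" "x \<in> nonneg_orthant"
  shows "0 \<le> tensor_apply k T x $ i"
  unfolding tensor_apply_def
  using assms prod_list_nonneg_orthant by (auto intro!: sum_nonneg mult_nonneg_nonneg)

lemma adjacency_tensor_nonneg: "0 \<le> adjacency_tensor k E js"
  by (simp add: adjacency_tensor_def)

text \<open>Only constant lists carry a nonzero entry, so the sum over lists collapses to a sum over
  vertices along \<open>replicate k\<close>. This map is injective because \<open>k\<close> is
  positive; for \<open>k = 0\<close> every vertex would give the empty list.\<close>

lemma tensor_form_degree:
  fixes E :: "'n::finite set set"
  assumes "k \<ge> 1"
  shows "tensor_form k (degree_tensor k E) x = (\<Sum>i\<in>UNIV. real (degree E i) * (x $ i) ^ k)"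
proof -
  have inj: "inj (replicate k :: 'n \<Rightarrow> 'n list)"
    using assms by (auto simp: inj_def)
  have hd: "hd (replicate k i) = i" for i :: 'n
    using assms by (cases k) auto
  have "tensor_form k (degree_tensor k E) x
      = (\<Sum>js\<in>range (replicate k). degree_tensor k E js * (\<Prod>j\<leftarrow>js. x $ j))"
    unfolding tensor_form_def
    by (rule sum.mono_neutral_right) (auto simp: finite_lists_length degree_tensor_def)
  also have "\<dots> = (\<Sum>i\<in>UNIV. real (degree E i) * (x $ i) ^ k)"
    by (subst sum.reindex[OF inj]) (simp add: degree_tensor_def hd prod_list_replicate)
  finally show ?thesis .
qed

lemma tensor_apply_degree:
  fixes E :: "'n::finite set set"
  assumes "k \<ge> 1"
  shows "tensor_apply k (degree_tensor k E) x $ i = real (degree E i) * (x $ i) ^ (k - 1)"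
proof -
  have "i # js = replicate k i \<longleftrightarrow> js = replicate (k - 1) i" for js
    using assms by (cases k) auto
  \<comment> \<open>The factor \<open>p\<close> stays arbitrary so that this serves as a rewrite
    rule under the sum, where the product depends on \<open>js\<close>.\<close>
  then have entry: "degree_tensor k E (i # js) * p
      = (if js = replicate (k - 1) i then real (degree E i) * p else 0)" for js p
    by (simp only: degree_tensor_def list.sel mult_zero_left split: if_split) simp
  have "tensor_apply k (degree_tensor k E) x $ i
      = (\<Sum>js | length js = k - 1.
          if js = replicate (k - 1) i then real (degree E i) * (\<Prod>j\<leftarrow>js. x $ j) else 0)"
    by (simp only: tensor_apply_def vec_lambda_beta entry)
  also have "\<dots> = real (degree E i) * (x $ i) ^ (k - 1)"
    by (simp add: sum.delta' finite_lists_length prod_list_replicate)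
  finally show ?thesis .
qed

text \<open>A nonzero entry has an edge as its index set, and all \<open>k \<ge> 2\<close> of its
  vertices enter the product.\<close>

lemma tensor_form_adjacency_axis:
  assumes "k \<ge> 2" "k_graph k E"
  shows "tensor_form k (adjacency_tensor k E) (axis i 1) = 0"
  unfolding tensor_form_def
proof (rule sum.neutral, intro ballI)
  fix js
  show "adjacency_tensor k E js * (\<Prod>j\<leftarrow>js. axis i 1 $ j) = 0"
  proof (cases "set js \<in> E")
    case True
    then have "card (set js) \<ge> 2" using assms by (auto simp: k_graph_def)
    then show ?thesis by (simp add: prod_list_axis_eq_0)
  qed (simp add: adjacency_tensor_def)
qed

text \<open>The leading index of an entry does not enter the product, so an edge leaves only
  \<open>k - 1\<close> vertices there. For \<open>k = 2\<close> the remaining vertex can be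
  \<open>i\<close> itself, and the component at each neighbour of \<open>i\<close> is then
  1.\<close>

lemma tensor_apply_adjacency_axis:
  assumes "k \<ge> 3" "k_graph k E"
  shows "tensor_apply k (adjacency_tensor k E) (axis i 1) = 0"
proof -
  have "adjacency_tensor k E (l # js) * (\<Prod>j\<leftarrow>js. axis i 1 $ j) = 0" for l js
  proof (cases "set (l # js) \<in> E")
    case True
    then have "card (insert l (set js)) \<ge> 3" using assms by (auto simp: k_graph_def)
    \<comment> \<open>Inserting \<open>l\<close> raises the cardinality by at most one.\<close>
    then have "card (set js) \<ge> 2" by (auto simp: card_insert_if split: if_splits)
    then show ?thesis by (simp add: prod_list_axis_eq_0)
  qed (simp add: adjacency_tensor_def)
  then show ?thesis
    unfolding tensor_apply_def vec_eq_iff vec_lambda_beta zero_index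
    by (intro allI sum.neutral ballI)
qed

lemma min_degree_le: "min_degree E \<le> degree E i"
  by (simp add: min_degree_def)

lemma min_degree_attained:
  obtains i where "degree E i = min_degree E"
proof -
  have "min_degree E \<in> range (degree E)"
    unfolding min_degree_def by (intro Min_in) auto
  then show thesis using that by (metis rangeE)
qed

lemma signless_laplacian_eq:
  "signless_laplacian k E = (\<lambda>js. degree_tensor k E js + adjacency_tensor k E js)"
  by (simp add: fun_eq_iff signless_laplacian_def)

lemma axis_in_nonneg_orthant: "axis i 1 \<in> nonneg_orthant"
  by (simp add: nonneg_orthant_def axis_def)

lemma Hplus_eigenvalue_min_degree:
  assumes "k \<ge> 3" "k_graph k E"
  shows "Hplus_eigenvalue k (signless_laplacian k E) (real (min_degree E))"
proof -
  obtain i where i: "degree E i = min_degree E" by (rule min_degree_attained)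
  have "tensor_apply k (signless_laplacian k E) (axis i 1)
      = real (min_degree E) *\<^sub>R vec_power (axis i 1) (k - 1)"
  proof (intro vec_eq_iff[THEN iffD2] allI)
    fix j
    have "tensor_apply k (signless_laplacian k E) (axis i 1) $ j
        = real (degree E j) * (axis i 1 $ j) ^ (k - 1)"
      using assms
      by (simp add: signless_laplacian_eq tensor_apply_add tensor_apply_adjacency_axis
          tensor_apply_degree)
    \<comment> \<open>At \<open>i\<close> the degree is the minimum one; elsewhere both sides
      vanish, since the exponent \<open>k - 1\<close> is positive.\<close>
    then show "tensor_apply k (signless_laplacian k E) (axis i 1) $ j
        = (real (min_degree E) *\<^sub>R vec_power (axis i 1) (k - 1)) $ j"
      using assms(1) i by (cases "j = i") (simp_all add: vec_power_def axis_def)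
  qed
  moreover have "axis i (1::real) \<noteq> 0"
    by (simp add: axis_eq_0_iff)
  ultimately show ?thesis
    unfolding Hplus_eigenvalue_def using axis_in_nonneg_orthant by blast
qed

lemma min_degree_le_Hplus_eigenvalue:
  assumes "k \<ge> 1" "Hplus_eigenvalue k (signless_laplacian k E) l"
  shows "real (min_degree E) \<le> l"
proof -
  obtain x where x: "x \<in> nonneg_orthant" "x \<noteq> 0"
    and eq: "tensor_apply k (signless_laplacian k E) x = l *\<^sub>R vec_power x (k - 1)"
    using assms(2) by (auto simp: Hplus_eigenvalue_def)
  then obtain i where "x $ i \<noteq> 0" by (auto simp: vec_eq_iff)
  then have pos: "0 < x $ i" using x(1) by (simp add: nonneg_orthant_def order_less_le)
  have "real (degree E i) * (x $ i) ^ (k - 1)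
      \<le> tensor_apply k (signless_laplacian k E) x $ i"
    using tensor_apply_nonneg[of "adjacency_tensor k E" x k i] x(1)
    by (simp add: signless_laplacian_eq tensor_apply_add tensor_apply_degree[OF assms(1)]
        adjacency_tensor_nonneg)
  also have "\<dots> = l * (x $ i) ^ (k - 1)"
    by (simp add: eq vec_power_def)
  \<comment> \<open>Cancel the positive factor \<open>(x $ i) ^ (k - 1)\<close>.\<close>
  finally have "real (degree E i) \<le> l" using pos by simp
  then show ?thesis using min_degree_le[of E i] by linarith
qed

text \<open>Both sides are homogeneous of degree \<open>k\<close>, so the bound needs no
  normalisation; setting the power sum to 1 gives the lower bound for the minimum.\<close>

lemma min_degree_le_tensor_form:
  assumes "k \<ge> 1" "x \<in> nonneg_orthant"
  shows "real (min_degree E) * (\<Sum>i\<in>UNIV. (x $ i) ^ k)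
    \<le> tensor_form k (signless_laplacian k E) x"
proof -
  have "real (min_degree E) * (\<Sum>i\<in>UNIV. (x $ i) ^ k)
      \<le> (\<Sum>i\<in>UNIV. real (degree E i) * (x $ i) ^ k)"
    unfolding sum_distrib_left using assms(2)
    by (intro sum_mono mult_right_mono) (auto simp: min_degree_le nonneg_orthant_def)
  then show ?thesis
    using tensor_form_nonneg[of "adjacency_tensor k E" x k] assms(2)
    by (simp add: signless_laplacian_eq tensor_form_add tensor_form_degree[OF assms(1)]
        adjacency_tensor_nonneg)
qed

text \<open>The weight \<open>f\<close> covers two uses: the degrees give the value of the form at a
  unit vector, and the constant 1 shows that this vector meets the constraint.\<close>

lemma sum_axis_power:
  fixes f :: "'n::finite \<Rightarrow> real"
  assumes "k \<ge> 1"
  shows "(\<Sum>j\<in>UNIV. f j * (axis i 1 $ j) ^ k) = f i"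
proof -
  have "(\<Sum>j\<in>UNIV. f j * (axis i 1 $ j) ^ k) = (\<Sum>j\<in>UNIV. if j = i then f j else 0)"
    using assms by (intro sum.cong) (auto simp: axis_def)
  then show ?thesis by simp
qed

theorem theorem15:
  fixes k :: nat and E :: "'n::finite set set"
  assumes "k \<ge> 2"
    and "k_graph k E"
    and "no_isolated_vertex E"
  shows "(k \<ge> 3 \<longrightarrow>
            is_minimum (real (min_degree E)) {l. Hplus_eigenvalue k (signless_laplacian k E) l})
       \<and> is_minimum (real (min_degree E))
            {tensor_form k (signless_laplacian k E) x | x.
               x \<in> nonneg_orthant \<and> (\<Sum>i\<in>UNIV. (x $ i) ^ k) = 1}"
proof -
  have k: "k \<ge> 1" using assms(1) by simp
  obtain i where i: "degree E i = min_degree E" by (rule min_degree_attained)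
  have "tensor_form k (signless_laplacian k E) (axis i 1) = real (min_degree E)"
    using assms(1,2) k i
    by (simp add: signless_laplacian_eq tensor_form_add tensor_form_adjacency_axis
        tensor_form_degree sum_axis_power)
  moreover have "(\<Sum>j\<in>UNIV. (axis i (1::real) $ j) ^ k) = 1"
    using sum_axis_power[OF k, of "\<lambda>_. 1" i] by simp
  ultimately have attained: "\<exists>x. real (min_degree E) = tensor_form k (signless_laplacian k E) x
      \<and> x \<in> nonneg_orthant \<and> (\<Sum>j\<in>UNIV. (x $ j) ^ k) = 1"
    using axis_in_nonneg_orthant[of i] by metis
  have bound: "real (min_degree E) \<le> tensor_form k (signless_laplacian k E) x"
    if "x \<in> nonneg_orthant" "(\<Sum>j\<in>UNIV. (x $ j) ^ k) = 1" for x
    using min_degree_le_tensor_form[OF k that(1), of E] that(2) by simp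
  \<comment> \<open>The premise \<open>k \<ge> 3\<close> of the attainment lemma is left open here
    and supplied by the implication in the goal; the lower bound on eigenvalues holds for all
    \<open>k \<ge> 1\<close>.\<close>
  show ?thesis
    unfolding is_minimum_def
    using attained bound Hplus_eigenvalue_min_degree[OF _ assms(2)]
      min_degree_le_Hplus_eigenvalue[OF k] by auto
qed

end
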